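(* Let $P$ be a labeled hexagon in $\mathbb{RP}^2$ in the domain of Glick's operator, and put $G_P=L_P-3I$, $$\mathcal S(P)=\tfrac12\operatorname{tr}\bigl((G_P-I)^2\bigr),\qquad\mathcal R(P)=\det(G_P-I).$$ Then $\mathcal S(P)$ and $\mathcal R(P)$ are projective invariants and $$\chi_{G_P}(t)=(t-1)^3-\mathcal S(P)(t-1)-\mathcal R(P).$$ With $m_{ij}=c_{ij}c_{ji}$ and $\Gamma_{ijk}=c_{ij}c_{jk}c_{ki}$ (the $c_{ij}$ being the bracket ratios defined in the context), $$\mathcal S(P)=\sum_{1\le i<j\le6}m_{ij}-3,\qquad\mathcal R(P)=2\mathcal S(P)-\sum_{1\le i<j<k\le6}(\Gamma_{ijk}+\Gamma_{ikj}).$$ Put $\Delta_P=4\mathcal S(P)^3-27\mathcal R(P)^2$. Then: (i) $\Delta_P>0$ if and only if $G_P$ has three distinct real eigenvalues. (ii) $\Delta_P=0$ if and only if $G_P$ has a repeated real eigenvalue. More precisely, in this case there is a unique $s\in\mathbb{R}$ such that $\mathcal S(P)=3s^2$, $\mathcal R(P)=2s^3$, and $\operatorname{Spec}(G_P)=\{1+2s,1-s,1-s\}$. The case $s=0$ is the triple spectrum $\{1,1,1\}$. (iii) $\Delta_P<0$ if and only if $G_P$ has one real eigenvalue and a non-real conjugate pair. In this case let $r$ be the unique real root of $z^3-\mathcal S(P)z-\mathcal R(P)=0$ and put $\omega=\sqrt{\frac{3r^2}4-\mathcal S(P)}$. Then $\omega>0$ and $$\operatorname{Spec}(G_P)=\left\{1+r,\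 1-\tfrac r2+\mathrm i\omega,\ 1-\tfrac r2-\mathrm i\omega\right\}.$$ Moreover, $$|1+r|^2-\left|1-\tfrac r2+\mathrm i\omega\right|^2=3r+\mathcal S(P).$$ Thus the real eigenvalue is dominant, has the same modulus as the non-real pair, or is subordinate according as $3r+\mathcal S(P)$ is positive, zero, or negative. (iv) Suppose that $G_P$ has three distinct real eigenvalues. Two of them have the same modulus if and only if $$\mathcal R(P)=8-2\mathcal S(P),\qquad\mathcal S(P)>3,\qquad\mathcal S(P)\ne12.$$ On this locus $\operatorname{Spec}(G_P)=\{3,\sqrt{\mathcal S(P)-3},-\sqrt{\mathcal S(P)-3}\}$. The eigenvalue $3$ is uniquely dominant when $3<\mathcal S(P)<12$, whereas the opposite pair has the common maximal modulus when $\mathcal S(P)>12$.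
   Context: Glick's operator: for a labeled projective $n$-gon $P=(p_1,\dots,p_n)$ (indices modulo $n$; here $n=6$) such that every consecutive triple $p_{i-1},p_i,p_{i+1}$ is noncollinear (the "domain of Glick's operator"), with nonzero homogeneous lifts $\widetilde p_i\in\mathbb{R}^3$, $$L_P(v)=nv-\sum_{j=1}^n\frac{\det(\widetilde p_{j-1},v,\widetilde p_{j+1})}{\det(\widetilde p_{j-1},\widetilde p_j,\widetilde p_{j+1})}\,\widetilde p_j ,\qquad v\in\mathbb{R}^3,$$ independent of the lifts. Brackets: $[ijk]=\det(\widetilde p_i,\widetilde p_j,\widetilde p_k)$ and $c_{ij}=\dfrac{[i-1,j,i+1]}{[i-1,i,i+1]}$, indices modulo $n$. $\chi_A(t)=\det(tI-A)$. Projective invariant means unchanged when $P$ is replaced by $\psi(P)$ for a projective transformation $\psi$. Spectra are listed with multiplicity. *)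

theory Defs
  imports "HOL-Analysis.Analysis" "HOL-Computational_Algebra.Polynomial"
begin

section \<open>Labeled polygons in the real projective plane\<close>

text \<open>Points of the projective plane are the lines through the origin of \<open>\<real>\<^sup>3\<close>.\<close>

definition RP2 :: "(real^3) set set" where
  "RP2 = {p. subspace p \<and> dim p = 1}"

definition projective_transformation :: "((real^3) set \<Rightarrow> (real^3) set) \<Rightarrow> bool" where
  "projective_transformation \<psi> \<longleftrightarrow>
     (\<exists>A :: real^3^3. invertible A \<and> (\<forall>p\<in>RP2. \<psi> p = (\<lambda>v. A *v v) ` p))"

definition collinear3 :: "(real^3) set \<Rightarrow> (real^3) set \<Rightarrow> (real^3) set \<Rightarrow> bool" where
  "collinear3 p q r \<longleftrightarrow> (\<exists>l. subspace l \<and> dim l = 2 \<and> p \<subseteq> l \<and> q \<subseteq> l \<and> r \<subseteq> l)"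

text \<open>A labeled \<open>n\<close>-gon has its indices modulo \<open>n\<close>, so it is an \<open>n\<close>-periodic family over
  the integers; its vertices are \<open>P 1, \<dots>, P n\<close>.\<close>

definition polygon :: "nat \<Rightarrow> (int \<Rightarrow> (real^3) set) \<Rightarrow> bool" where
  "polygon n P \<longleftrightarrow> (\<forall>i. P i \<in> RP2) \<and> (\<forall>i. P (i + int n) = P i)"

definition glick_domain :: "nat \<Rightarrow> (int \<Rightarrow> (real^3) set) \<Rightarrow> bool" where
  "glick_domain n P \<longleftrightarrow> polygon n P \<and> (\<forall>i. \<not> collinear3 (P (i - 1)) (P i) (P (i + 1)))"

definition is_lift :: "nat \<Rightarrow> (int \<Rightarrow> (real^3) set) \<Rightarrow> (int \<Rightarrow> real^3) \<Rightarrow> bool" where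
  "is_lift n P q \<longleftrightarrow> (\<forall>i. q i \<in> P i \<and> q i \<noteq> 0) \<and> (\<forall>i. q (i + int n) = q i)"


section \<open>Brackets and Glick's operator\<close>

definition bracket :: "real^3 \<Rightarrow> real^3 \<Rightarrow> real^3 \<Rightarrow> real" where
  "bracket u v w = det (vector [u, v, w] :: real^3^3)"

definition c_ratio :: "(int \<Rightarrow> real^3) \<Rightarrow> int \<Rightarrow> int \<Rightarrow> real" where
  "c_ratio q i j =
     bracket (q (i - 1)) (q j) (q (i + 1)) / bracket (q (i - 1)) (q i) (q (i + 1))"

definition m_coeff :: "(int \<Rightarrow> real^3) \<Rightarrow> int \<Rightarrow> int \<Rightarrow> real" where
  "m_coeff q i j = c_ratio q i j * c_ratio q j i"

definition Gamma_coeff :: "(int \<Rightarrow> real^3) \<Rightarrow> int \<Rightarrow> int \<Rightarrow> int \<Rightarrow> real" where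
  "Gamma_coeff q i j k = c_ratio q i j * c_ratio q j k * c_ratio q k i"

definition glick_of_lift :: "nat \<Rightarrow> (int \<Rightarrow> real^3) \<Rightarrow> real^3 \<Rightarrow> real^3" where
  "glick_of_lift n q v = real n *\<^sub>R v -
     (\<Sum>j = 1..int n.
        (bracket (q (j - 1)) v (q (j + 1)) / bracket (q (j - 1)) (q j) (q (j + 1))) *\<^sub>R q j)"

text \<open>The lift chosen here is immaterial, see \<open>glick_eq\<close> below.\<close>

definition glick :: "nat \<Rightarrow> (int \<Rightarrow> (real^3) set) \<Rightarrow> real^3 \<Rightarrow> real^3" where
  "glick n P = glick_of_lift n (\<lambda>i. SOME v. v \<in> P i \<and> v \<noteq> 0)"

lemma bracket_expand:
  "bracket u v w = u$1 * v$2 * w$3 + u$2 * v$3 * w$1 + u$3 * v$1 * w$2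
                 - u$1 * v$3 * w$2 - u$2 * v$1 * w$3 - u$3 * v$2 * w$1"
  unfolding bracket_def det_3 by simp

lemma bracket_add: "bracket u (v + v') w = bracket u v w + bracket u v' w"
  unfolding bracket_expand by (simp add: algebra_simps)

lemma bracket_scale:
  "bracket (a *\<^sub>R u) v w = a * bracket u v w"
  "bracket u (a *\<^sub>R v) w = a * bracket u v w"
  "bracket u v (a *\<^sub>R w) = a * bracket u v w"
  unfolding bracket_expand by (simp_all add: algebra_simps)

lemma RP2_eq_span:
  assumes "p \<in> RP2" "v \<in> p" "v \<noteq> 0"
  shows "p = span {v}"
proof -
  have p: "subspace p" "dim p = 1" using assms(1) by (simp_all add: RP2_def)
  have "p \<subseteq> span {v}"
    using assms p by (intro card_ge_dim_independent) simp_all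
  moreover have "span {v} \<subseteq> p"
    using assms(2) p(1) by (intro span_minimal) simp_all
  ultimately show ?thesis by blast
qed

lemma RP2_exists_nonzero:
  assumes "p \<in> RP2" shows "\<exists>v. v \<in> p \<and> v \<noteq> 0"
proof (rule ccontr)
  assume "\<not> ?thesis"
  then have "p \<subseteq> {0}" by auto
  then have "dim p = 0" by simp
  with assms show False by (simp add: RP2_def)
qed

lemma glick_eq:
  assumes P: "polygon n P" and q: "is_lift n P q"
  shows "glick n P = glick_of_lift n q"
proof -
  define w where "w = (\<lambda>i. SOME v. v \<in> P i \<and> v \<noteq> 0)"
  have P': "P i \<in> RP2" for i using P by (simp add: polygon_def)
  have w: "w i \<in> P i \<and> w i \<noteq> 0" for i
    unfolding w_def by (rule someI_ex[OF RP2_exists_nonzero[OF P']])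
  have "\<exists>a. a \<noteq> 0 \<and> q i = a *\<^sub>R w i" for i
  proof -
    have "P i = span {w i}" using w[of i] by (intro RP2_eq_span[OF P']) simp_all
    then have "q i \<in> span {w i}" "q i \<noteq> 0" using q unfolding is_lift_def by blast+
    then show ?thesis by (auto simp: span_singleton)
  qed
  then obtain a where a: "a i \<noteq> 0" "q i = a i *\<^sub>R w i" for i by metis
  have "glick_of_lift n w v = glick_of_lift n q v" for v
    unfolding glick_of_lift_def a(2) bracket_scale
    by (intro arg_cong2[of _ _ _ _ "(-)"] sum.cong refl) (simp add: a(1))
  then show ?thesis unfolding glick_def w_def by blast
qed

lemma linear_glick: "linear (glick n P)"
proof -
  have "linear (glick_of_lift n q)" for q
    unfolding glick_of_lift_def
    by (rule linearI)
      (simp_all add: bracket_add bracket_scale add_divide_distrib scaleR_add_left scaleR_add_right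
        sum.distrib scaleR_diff_right scaleR_sum_right mult.commute)
  then show ?thesis by (simp add: glick_def)
qed


section \<open>Characteristic polynomial and spectrum\<close>

definition charpoly :: "'a::comm_ring_1^'n^'n \<Rightarrow> 'a poly" where
  "charpoly A = det (mat [:0, 1:] - map_matrix (\<lambda>a. [:a:]) A)"

definition spectrum :: "real^'n^'n \<Rightarrow> complex multiset" where
  "spectrum A = proots (charpoly (map_matrix complex_of_real A))"

definition dominant_eigenvalues :: "real^'n^'n \<Rightarrow> complex set" where
  "dominant_eigenvalues A = {z. z \<in># spectrum A \<and> (\<forall>w\<in>#spectrum A. cmod w \<le> cmod z)}"

definition three_distinct_real_eigenvalues :: "real^3^3 \<Rightarrow> bool" where
  "three_distinct_real_eigenvalues A \<longleftrightarrow>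
     (\<exists>x y z :: real. x \<noteq> y \<and> x \<noteq> z \<and> y \<noteq> z \<and>
        spectrum A = {#of_real x, of_real y, of_real z#})"

definition has_repeated_real_eigenvalue :: "real^3^3 \<Rightarrow> bool" where
  "has_repeated_real_eigenvalue A \<longleftrightarrow> (\<exists>x :: real. count (spectrum A) (of_real x) \<ge> 2)"

definition has_nonreal_conjugate_pair :: "real^3^3 \<Rightarrow> bool" where
  "has_nonreal_conjugate_pair A \<longleftrightarrow>
     (\<exists>(x :: real) z. z \<notin> \<real> \<and> spectrum A = {#of_real x, z, cnj z#})"

lemma poly_charpoly:
  fixes A :: "'a::comm_ring_1^'n^'n"
  shows "poly (charpoly A) t = det (mat t - A)"
proof -
  have "poly (of_int k) t = of_int k" for k by (cases k rule: int_cases2) simp_all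
  then show ?thesis
    unfolding charpoly_def det_def poly_sum poly_mult poly_prod
    by (intro sum.cong prod.cong arg_cong2[of _ _ _ _ "(*)"]) (simp_all add: mat_def)
qed

lemma in_spectrum_iff:
  fixes A :: "real^3^3"
  shows "z \<in># spectrum A \<longleftrightarrow> (\<exists>v. v \<noteq> 0 \<and> map_matrix complex_of_real A *v v = z *s v)"
proof -
  define B where "B = map_matrix complex_of_real A"
  have "coeff (charpoly B) 3 = 1"
    unfolding charpoly_def det_3 by (simp add: mat_def numeral_3_eq_3)
  then have "charpoly B \<noteq> 0" by auto
  then have "z \<in># spectrum A \<longleftrightarrow> det (mat z - B) = 0"
    by (simp add: spectrum_def B_def poly_charpoly)
  also have "\<dots> \<longleftrightarrow> \<not> (\<forall>v. (mat z - B) *v v = 0 \<longrightarrow> v = 0)"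
    using invertible_det_nz[of "mat z - B"] invertible_left_inverse[of "mat z - B"]
      matrix_left_invertible_ker[of "mat z - B"] by metis
  also have "\<dots> \<longleftrightarrow> (\<exists>v. v \<noteq> 0 \<and> B *v v = z *s v)"
  proof -
    have "mat z *v v = z *s v" for v :: "complex^3"
      by (simp add: vec_eq_iff matrix_vector_mult_def mat_def if_distrib if_distribR cong: if_cong)
    then show ?thesis by (simp add: matrix_vector_mult_diff_rdistrib) metis
  qed
  finally show ?thesis by (simp add: B_def)
qed


section \<open>The invariants of a hexagon\<close>

definition G_matrix :: "(int \<Rightarrow> (real^3) set) \<Rightarrow> real^3^3" where
  "G_matrix P = matrix (glick 6 P) - mat 3"

definition S_inv :: "(int \<Rightarrow> (real^3) set) \<Rightarrow> real" where
  "S_inv P = 1/2 * trace ((G_matrix P - mat 1) ** (G_matrix P - mat 1))"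

definition R_inv :: "(int \<Rightarrow> (real^3) set) \<Rightarrow> real" where
  "R_inv P = det (G_matrix P - mat 1)"

definition Delta :: "(int \<Rightarrow> (real^3) set) \<Rightarrow> real" where
  "Delta P = 4 * S_inv P ^ 3 - 27 * R_inv P ^ 2"

end

(*  G - I = 2I - K, where K is the sum of the six rank-one maps appearing in Glick's operator. The
    traces of K, K^2, K^3 are the cyclic sums of c_ii = 1, c_ij c_ji and c_ij c_jk c_ki over all
    indices; in particular tr K = 6, so G - I is traceless and its characteristic polynomial is the
    depressed cubic z^3 - S z - R. The ratios c_ij do not change under a linear map applied to the
    lifts, hence neither do S and R. Everything about the spectrum is read off the depressed cubic:
    a real root r always exists, and the discriminant equals (4S - 3r^2)(3r^2 - S)^2. *)

theory Submission
  imports Defs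
begin

section \<open>Traces and determinants of 3x3 matrices\<close>

text \<open>Expanding S and R in the eighteen coordinates of the lifts would be unwieldy. Each
  summand of \<open>K\<close> is an outer product of a lift \<open>q i\<close> with a covector
  \<open>r i\<close> that sends \<open>v\<close> to a quotient of brackets, and \<open>r i\<close>
  evaluated at \<open>q j\<close> is \<open>c_ratio q i j\<close>. Traces of powers of
  \<open>K\<close> therefore see the lifts only through these pairings, and Newton's identities,
  multiplied by 6 to clear denominators, turn the traces into the determinant. On the spectral side,
  the coefficients of the cubic and the multiset of its roots must determine each other: Vieta's
  relations give one direction, power sums over the multiset the other.\<close>

lemma det_mat_diff_3:
  fixes K :: "'a::comm_ring_1^3^3"
  shows "6 * det (mat s - K) = 6 * s ^ 3 - 6 * s\<^sup>2 * trace K + 3 * s * ((trace K)\<^sup>2 - trace (K ** K))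
           - ((trace K) ^ 3 - 3 * trace K * trace (K ** K) + 2 * trace (K ** K ** K))"
  by (simp add: det_3 trace_def matrix_matrix_mult_def sum_3 mat_def power2_eq_square power3_eq_cube algebra_simps)

lemma trace_square_mat_diff_3:
  fixes K :: "'a::comm_ring_1^3^3"
  shows "trace ((mat s - K) ** (mat s - K)) = 3 * s\<^sup>2 - 2 * s * trace K + trace (K ** K)"
  by (simp add: trace_def matrix_matrix_mult_def sum_3 mat_def power2_eq_square algebra_simps)

text \<open>At s = 0 Newton's identities reduce to tr M^3 = 3 det M when tr M = 0. This eliminates
  the cubic trace and leaves the quantities by which \<open>S_inv\<close> and \<open>R_inv\<close>
  are defined.\<close>

lemma det_mat_diff_traceless_3:
  fixes M :: "'a::field_char_0^3^3"
  assumes "trace M = 0"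
  shows "det (mat s - M) = s ^ 3 - trace (M ** M) / 2 * s - det M"
proof -
  have "det (mat 0 - M) = - det M"
    by (simp add: det_3 mat_def algebra_simps)
  then have "trace (M ** M ** M) = 3 * det M"
    using det_mat_diff_3[of 0 M] assms by simp
  then have "6 * det (mat s - M) = 6 * (s ^ 3 - trace (M ** M) / 2 * s - det M)"
    using det_mat_diff_3[of s M] assms by (simp add: right_diff_distrib)
  then show ?thesis by (simp only: mult_cancel_left) simp
qed

text \<open>Generic in the field because it is used twice: over the reals for the characteristic
  polynomial itself, over the complex numbers for the polynomial behind
  \<open>spectrum\<close>.\<close>

lemma poly_charpoly_of_real_3:
  fixes A :: "real^3^3"
  assumes "trace (A - mat 1) = 0"
  shows "poly (charpoly (map_matrix of_real A :: 'a::real_field^3^3)) z =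
    (z - 1) ^ 3 - of_real (1/2 * trace ((A - mat 1) ** (A - mat 1))) * (z - 1) - of_real (det (A - mat 1))"
proof -
  define M :: "'a^3^3" where "M = map_matrix of_real (A - mat 1)"
  have tr: "trace M = of_real (trace (A - mat 1))"
    by (simp add: M_def trace_def)
  have tr2: "trace (M ** M) = of_real (trace ((A - mat 1) ** (A - mat 1)))"
    by (simp add: M_def trace_def matrix_matrix_mult_def)
  have det: "det M = of_real (det (A - mat 1))"
    by (simp add: M_def det_3)
  have "mat z - map_matrix of_real A = mat (z - 1) - M"
    by (simp add: M_def vec_eq_iff mat_def)
  then show ?thesis
    using det_mat_diff_traceless_3[of M "z - 1"] assms
    by (simp add: poly_charpoly tr tr2 det of_real_divide)
qed

text \<open>Two outer products multiply to a scalar, the pairing of the inner covector with the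
  inner vector, times an outer product. Products of such sums thus keep their shape and can be
  iterated.\<close>

lemma matrix_sum_outer_mult:
  fixes q :: "'i \<Rightarrow> 'a::comm_ring_1^'n" and r :: "'j \<Rightarrow> 'a^'n"
  shows "(\<chi> a b. \<Sum>i\<in>I. q i $ a * r' i $ b) ** (\<chi> a b. \<Sum>j\<in>J. q' j $ a * r j $ b) =
    (\<chi> a b. \<Sum>i\<in>I. \<Sum>j\<in>J. (\<Sum>k\<in>UNIV. r' i $ k * q' j $ k) * q i $ a * r j $ b)"
proof -
  have "(\<Sum>k\<in>UNIV. (\<Sum>i\<in>I. q i $ a * r' i $ k) * (\<Sum>j\<in>J. q' j $ k * r j $ b)) =
        (\<Sum>i\<in>I. \<Sum>j\<in>J. (\<Sum>k\<in>UNIV. r' i $ k * q' j $ k) * q i $ a * r j $ b)" for a b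
  proof -
    have "(\<Sum>k\<in>UNIV. (\<Sum>i\<in>I. q i $ a * r' i $ k) * (\<Sum>j\<in>J. q' j $ k * r j $ b)) =
          (\<Sum>k\<in>UNIV. \<Sum>i\<in>I. \<Sum>j\<in>J. r' i $ k * q' j $ k * q i $ a * r j $ b)"
      by (simp add: sum_product mult_ac)
    also have "\<dots> = (\<Sum>i\<in>I. \<Sum>k\<in>UNIV. \<Sum>j\<in>J. r' i $ k * q' j $ k * q i $ a * r j $ b)"
      by (rule sum.swap)
    also have "\<dots> = (\<Sum>i\<in>I. \<Sum>j\<in>J. \<Sum>k\<in>UNIV. r' i $ k * q' j $ k * q i $ a * r j $ b)"
      by (intro sum.cong refl sum.swap)
    finally show ?thesis by (simp add: sum_distrib_right)
  qed
  then show ?thesis by (simp add: matrix_matrix_mult_def)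
qed

lemma trace_sum_outer:
  fixes q :: "'i \<Rightarrow> 'a::comm_ring_1^'n"
  shows "trace (\<chi> a b. \<Sum>i\<in>I. q i $ a * r i $ b) = (\<Sum>i\<in>I. \<Sum>k\<in>UNIV. r i $ k * q i $ k)"
  unfolding trace_def by (simp add: sum.swap[of _ I] mult.commute)

text \<open>The pairings are absorbed into the covectors: \<open>K ** K\<close> is again a single
  sum of outer products over \<open>I\<close>, with the same \<open>q i\<close> and with
  \<open>r i\<close> replaced by the combination of the \<open>r j\<close> with weights
  \<open>c i j\<close>.\<close>

lemma trace_sum_outer_square:
  fixes q r :: "'i \<Rightarrow> 'a::comm_ring_1^'n" and I :: "'i set"
  defines "K \<equiv> \<chi> a b. \<Sum>i\<in>I. q i $ a * r i $ b"
    and "c \<equiv> \<lambda>i j. \<Sum>k\<in>UNIV. r i $ k * q j $ k"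
  shows "trace (K ** K) = (\<Sum>i\<in>I. \<Sum>j\<in>I. c i j * c j i)"
proof -
  have "K ** K = (\<chi> a b. \<Sum>i\<in>I. q i $ a * (\<Sum>j\<in>I. c i j *s r j) $ b)"
    unfolding K_def matrix_sum_outer_mult c_def
    by (simp add: sum_distrib_left mult_ac)
  then have "trace (K ** K) = (\<Sum>i\<in>I. \<Sum>k\<in>UNIV. (\<Sum>j\<in>I. c i j *s r j) $ k * q i $ k)"
    by (simp only: trace_sum_outer)
  also have "\<dots> = (\<Sum>i\<in>I. \<Sum>k\<in>UNIV. \<Sum>j\<in>I. c i j * (r j $ k * q i $ k))"
    by (simp add: sum_distrib_right mult.assoc)
  also have "\<dots> = (\<Sum>i\<in>I. \<Sum>j\<in>I. \<Sum>k\<in>UNIV. c i j * (r j $ k * q i $ k))"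
    by (intro sum.cong refl sum.swap)
  finally show ?thesis by (simp add: c_def sum_distrib_left)
qed

lemma trace_sum_outer_cube:
  fixes q r :: "'i \<Rightarrow> 'a::comm_ring_1^'n" and I :: "'i set"
  defines "K \<equiv> \<chi> a b. \<Sum>i\<in>I. q i $ a * r i $ b"
    and "c \<equiv> \<lambda>i j. \<Sum>k\<in>UNIV. r i $ k * q j $ k"
  shows "trace (K ** K ** K) = (\<Sum>i\<in>I. \<Sum>j\<in>I. \<Sum>k\<in>I. c i j * c j k * c k i)"
proof -
  define r2 where "r2 = (\<lambda>i. \<Sum>j\<in>I. c i j *s r j)"
  define r3 where "r3 = (\<lambda>i. \<Sum>j\<in>I. c i j *s r2 j)"
  \<comment> \<open>The pairings of the covectors of \<open>K ** K\<close> with the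
    \<open>q j\<close> are the entries of the square of the matrix \<open>c\<close>.\<close>
  have c_r2: "(\<Sum>k\<in>UNIV. r2 i $ k * q j $ k) = (\<Sum>l\<in>I. c i l * c l j)" for i j
    unfolding r2_def c_def
    by (simp add: sum_distrib_right sum_distrib_left sum.swap[of _ I] mult_ac)
  have K2: "K ** K = (\<chi> a b. \<Sum>i\<in>I. q i $ a * r2 i $ b)"
    unfolding K_def matrix_sum_outer_mult c_def r2_def
    by (simp add: sum_distrib_left mult_ac)
  have K3: "K ** K ** K = (\<chi> a b. \<Sum>i\<in>I. q i $ a * (\<Sum>j\<in>I. (\<Sum>l\<in>I. c i l * c l j) *s r j) $ b)"
    \<comment> \<open>Two stages: \<open>K ** K\<close> must become one sum with covectors
      \<open>r2\<close> before the remaining factor \<open>K\<close> is opened.\<close>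
    unfolding K2 unfolding K_def matrix_sum_outer_mult c_r2
    by (simp add: sum_distrib_left mult_ac)
  have "trace (K ** K ** K) = (\<Sum>i\<in>I. \<Sum>k\<in>UNIV. (\<Sum>j\<in>I. (\<Sum>l\<in>I. c i l * c l j) *s r j) $ k * q i $ k)"
    unfolding K3 trace_sum_outer ..
  also have "\<dots> = (\<Sum>i\<in>I. \<Sum>k\<in>UNIV. \<Sum>j\<in>I. (\<Sum>l\<in>I. c i l * c l j) * (r j $ k * q i $ k))"
    by (simp add: sum_distrib_right mult.assoc)
  also have "\<dots> = (\<Sum>i\<in>I. \<Sum>j\<in>I. \<Sum>k\<in>UNIV. (\<Sum>l\<in>I. c i l * c l j) * (r j $ k * q i $ k))"
    by (intro sum.cong refl sum.swap)
  also have "\<dots> = (\<Sum>i\<in>I. \<Sum>j\<in>I. \<Sum>l\<in>I. c i l * c l j * c j i)"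
    by (simp add: c_def sum_distrib_left[symmetric] sum_distrib_right[symmetric])
  also have "\<dots> = (\<Sum>i\<in>I. \<Sum>l\<in>I. \<Sum>j\<in>I. c i l * c l j * c j i)"
    by (intro sum.cong refl sum.swap)
  finally show ?thesis .
qed

section \<open>Brackets and lifts\<close>

text \<open>A zero bracket yields a nonzero kernel vector of the matrix with rows \<open>u\<close>,
  \<open>v\<close>, \<open>w\<close>. Its orthogonal plane is a projective line through all three
  points, also when some of them coincide.\<close>

lemma bracket_nonzero_if_not_collinear3:
  assumes P: "p \<in> RP2" "q \<in> RP2" "r \<in> RP2" and nc: "\<not> collinear3 p q r"
    and u: "u \<in> p" "u \<noteq> 0" and v: "v \<in> q" "v \<noteq> 0" and w: "w \<in> r" "w \<noteq> 0"
  shows "bracket u v w \<noteq> 0"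
proof
  assume "bracket u v w = 0"
  then have "\<not> invertible (vector [u, v, w] :: real^3^3)"
    by (simp add: bracket_def invertible_det_nz)
  then obtain n where n: "n \<noteq> 0" "(vector [u, v, w] :: real^3^3) *v n = 0"
    using invertible_left_inverse matrix_left_invertible_ker by metis
  define l where "l = {x. n \<bullet> x = 0}"
  have l: "subspace l" "dim l = 2"
    using n(1) by (simp_all add: l_def subspace_hyperplane dim_hyperplane)
  have "u \<bullet> n = 0" "v \<bullet> n = 0" "w \<bullet> n = 0"
    using n(2) by (auto simp: vec_eq_iff matrix_vector_mult_def inner_vec_def forall_3 sum_3)
  then have "u \<in> l" "v \<in> l" "w \<in> l" by (simp_all add: l_def inner_commute)
  then have "span {u} \<subseteq> l" "span {v} \<subseteq> l" "span {w} \<subseteq> l"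
    using l(1) by (simp_all add: span_minimal)
  then have "p \<subseteq> l" "q \<subseteq> l" "r \<subseteq> l"
    using RP2_eq_span P u v w by metis+
  with l nc show False unfolding collinear3_def by blast
qed

lemma bracket_matrix_mult: "bracket (A *v u) (A *v v) (A *v w) = det A * bracket u v w"
  unfolding bracket_def by (simp add: det_3 matrix_vector_mult_def sum_3) algebra

lemma c_ratio_matrix_mult:
  assumes "invertible A"
  shows "c_ratio (\<lambda>i. A *v q i) i j = c_ratio q i j"
  using assms by (simp add: c_ratio_def bracket_matrix_mult invertible_det_nz)

lemma polygon_lift_exists:
  assumes "polygon n P"
  obtains q where "is_lift n P q"
proof
  \<comment> \<open>The chosen vector depends only on the point \<open>P i\<close>, so it inherits
    the periodicity of \<open>P\<close>.\<close>
  show "is_lift n P (\<lambda>i. SOME v. v \<in> P i \<and> v \<noteq> 0)"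
    using assms someI_ex[OF RP2_exists_nonzero]
    unfolding is_lift_def polygon_def by simp
qed

lemma bracket_lift_nonzero:
  assumes "glick_domain n P" "is_lift n P q"
  shows "bracket (q (i - 1)) (q i) (q (i + 1)) \<noteq> 0"
  using assms unfolding glick_domain_def polygon_def is_lift_def
  by (intro bracket_nonzero_if_not_collinear3[of "P (i - 1)" "P i" "P (i + 1)"]) auto

lemma polygon_projective_image:
  assumes "invertible A" and \<psi>: "\<And>p. p \<in> RP2 \<Longrightarrow> \<psi> p = (\<lambda>v. A *v v) ` p"
    and P: "polygon n P"
  shows "polygon n (\<lambda>i. \<psi> (P i))"
proof -
  have inj: "inj (\<lambda>v. A *v v)" using assms(1) by (simp add: inj_matrix_vector_mult)
  have "\<psi> p \<in> RP2" if "p \<in> RP2" for p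
    using that inj by (auto simp: \<psi> RP2_def linear_subspace_image dim_image_eq inj_on_subset)
  then show ?thesis using P by (simp add: polygon_def)
qed

lemma is_lift_projective_image:
  assumes "invertible A" and \<psi>: "\<And>p. p \<in> RP2 \<Longrightarrow> \<psi> p = (\<lambda>v. A *v v) ` p"
    and P: "polygon n P" and q: "is_lift n P q"
  shows "is_lift n (\<lambda>i. \<psi> (P i)) (\<lambda>i. A *v q i)"
proof -
  have inj: "inj (\<lambda>v. A *v v)" using assms(1) by (simp add: inj_matrix_vector_mult)
  have "A *v v \<noteq> 0" if "v \<noteq> 0" for v
    using injD[OF inj, of v 0] that by auto
  then show ?thesis using P q by (simp add: is_lift_def polygon_def \<psi>)
qed

section \<open>The invariants in terms of the bracket ratios\<close>

lemma sum_1_6: "(\<Sum>i = 1..6. f i) = f 1 + f 2 + f 3 + f 4 + f 5 + f (6::int)"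
proof -
  have "{1..6} = {1, 2, 3, 4, 5, 6::int}" by auto
  then show ?thesis by (simp add: add_ac)
qed

lemma sum_pairs_1_6:
  "(\<Sum>i = 1..6. \<Sum>j = i+1..6. f i j) =
     f 1 2 + f 1 3 + f 1 4 + f 1 5 + f 1 6 + f 2 3 + f 2 4 + f 2 5 + f 2 6 +
     f 3 4 + f 3 5 + f 3 6 + f 4 5 + f 4 6 + f 5 (6::int)"
proof -
  have "{2..6} = {2, 3, 4, 5, 6::int}" "{3..6} = {3, 4, 5, 6::int}" "{4..6} = {4, 5, 6::int}"
    "{5..6} = {5, 6::int}" "{7..6::int} = {}" by auto
  then show ?thesis by (simp add: sum_1_6 add_ac)
qed

lemma sum_triples_1_6:
  "(\<Sum>i = 1..6. \<Sum>j = i+1..6. \<Sum>k = j+1..6. f i j k) =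
     f 1 2 3 + f 1 2 4 + f 1 2 5 + f 1 2 6 + f 1 3 4 + f 1 3 5 + f 1 3 6 + f 1 4 5 + f 1 4 6 + f 1 5 6 +
     f 2 3 4 + f 2 3 5 + f 2 3 6 + f 2 4 5 + f 2 4 6 + f 2 5 6 +
     f 3 4 5 + f 3 4 6 + f 3 5 6 + f 4 5 (6::int)"
proof -
  have "{3..6} = {3, 4, 5, 6::int}" "{4..6} = {4, 5, 6::int}"
    "{5..6} = {5, 6::int}" "{7..6::int} = {}" by auto
  then show ?thesis by (simp add: sum_pairs_1_6 add_ac)
qed

lemma sum_square_1_6:
  fixes c :: "int \<Rightarrow> int \<Rightarrow> 'a::comm_ring_1"
  assumes "\<And>i. c i i = 1"
  shows "(\<Sum>i = 1..6. \<Sum>j = 1..6. c i j * c j i) = 6 + 2 * (\<Sum>i = 1..6. \<Sum>j = i+1..6. c i j * c j i)"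
  unfolding sum_pairs_1_6 unfolding sum_1_6 by (simp add: assms algebra_simps)

text \<open>Count of ordered triples: six constant ones contribute 1 each; a pair i < j arises from
  6 triples with exactly two equal entries, each contributing \<open>c i j * c j i\<close>; three
  distinct indices give two orientations, each with 3 rotations of equal value.\<close>

lemma sum_cube_1_6:
  fixes c :: "int \<Rightarrow> int \<Rightarrow> 'a::comm_ring_1"
  assumes "\<And>i. c i i = 1"
  shows "(\<Sum>i = 1..6. \<Sum>j = 1..6. \<Sum>k = 1..6. c i j * c j k * c k i) =
    6 + 6 * (\<Sum>i = 1..6. \<Sum>j = i+1..6. c i j * c j i) +
    3 * (\<Sum>i = 1..6. \<Sum>j = i+1..6. \<Sum>k = j+1..6. c i j * c j k * c k i + c i k * c k j * c j i)"
  \<comment> \<open>The nested ranges go first, since \<open>sum_1_6\<close> would rewrite their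
    outer sum and destroy the pattern.\<close>
  unfolding sum_triples_1_6 unfolding sum_pairs_1_6 unfolding sum_1_6
  by (simp add: assms algebra_simps)

text \<open>The domain condition enters through nonzero brackets of a lift, a form that passes to a
  projective image directly by \<open>bracket_matrix_mult\<close>.\<close>

lemma G_matrix_shift:
  assumes P: "polygon 6 P" and q: "is_lift 6 P q"
    and nz: "\<And>i. bracket (q (i - 1)) (q i) (q (i + 1)) \<noteq> 0"
  obtains K where "G_matrix P - mat 1 = mat 2 - K"
    "trace K = 6"
    "trace (K ** K) = 6 + 2 * (\<Sum>i = 1..6. \<Sum>j = i+1..6. m_coeff q i j)"
    "trace (K ** K ** K) = 6 + 6 * (\<Sum>i = 1..6. \<Sum>j = i+1..6. m_coeff q i j) +
       3 * (\<Sum>i = 1..6. \<Sum>j = i+1..6. \<Sum>k = j+1..6. Gamma_coeff q i j k + Gamma_coeff q i k j)"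
proof
  define r where "r = (\<lambda>j. \<chi> b. bracket (q (j - 1)) (axis b 1) (q (j + 1)) /
    bracket (q (j - 1)) (q j) (q (j + 1)))"
  define K where "K = (\<chi> a b. \<Sum>i = 1..6. q i $ a * r i $ b)"
  have c: "(\<Sum>k\<in>UNIV. r i $ k * q j $ k) = c_ratio q i j" for i j
  proof -
    \<comment> \<open>The bracket is linear in its middle slot, so it is determined by its values on
      the standard basis.\<close>
    have "bracket u v w = (\<Sum>k\<in>UNIV. bracket u (axis k 1) w * v $ k)" for u v w
      by (simp add: bracket_expand sum_3 axis_def algebra_simps)
    from this[of "q (i - 1)" "q j" "q (i + 1)"] show ?thesis
      by (simp add: r_def c_ratio_def sum_divide_distrib)
  qed
  have c1: "c_ratio q i i = 1" for i using nz[of i] by (simp add: c_ratio_def)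
  \<comment> \<open>The 2 is 6 - 3 - 1: the leading term of Glick's operator, the shift in
    \<open>G_matrix\<close>, and the identity.\<close>
  show "G_matrix P - mat 1 = mat 2 - K"
    unfolding G_matrix_def glick_eq[OF P q]
    by (auto simp: vec_eq_iff matrix_def mat_def glick_of_lift_def K_def r_def axis_def mult.commute)
  show "trace K = 6"
    unfolding K_def trace_sum_outer c by (simp add: c1)
  show "trace (K ** K) = 6 + 2 * (\<Sum>i = 1..6. \<Sum>j = i+1..6. m_coeff q i j)"
    unfolding K_def trace_sum_outer_square c m_coeff_def by (rule sum_square_1_6[OF c1])
  show "trace (K ** K ** K) = 6 + 6 * (\<Sum>i = 1..6. \<Sum>j = i+1..6. m_coeff q i j) +
       3 * (\<Sum>i = 1..6. \<Sum>j = i+1..6. \<Sum>k = j+1..6. Gamma_coeff q i j k + Gamma_coeff q i k j)"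
    unfolding K_def trace_sum_outer_cube c m_coeff_def Gamma_coeff_def by (rule sum_cube_1_6[OF c1])
qed

lemma trace_G_matrix_shift:
  assumes "polygon 6 P" "is_lift 6 P q" "\<And>i. bracket (q (i - 1)) (q i) (q (i + 1)) \<noteq> 0"
  shows "trace (G_matrix P - mat 1) = 0"
proof -
  obtain K where "G_matrix P - mat 1 = mat 2 - K" "trace K = 6"
    by (rule G_matrix_shift[OF assms])
  then show ?thesis by (simp add: trace_def mat_def sum_3)
qed

lemma S_inv_eq:
  assumes "polygon 6 P" "is_lift 6 P q" "\<And>i. bracket (q (i - 1)) (q i) (q (i + 1)) \<noteq> 0"
  shows "S_inv P = (\<Sum>i = 1..6. \<Sum>j = i+1..6. m_coeff q i j) - 3"
proof -
  obtain K where "G_matrix P - mat 1 = mat 2 - K" "trace K = 6"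
    "trace (K ** K) = 6 + 2 * (\<Sum>i = 1..6. \<Sum>j = i+1..6. m_coeff q i j)"
    by (rule G_matrix_shift[OF assms])
  \<comment> \<open>With m the sum of the \<open>m_coeff\<close>, the trace of the square is 12 - 24
    + 6 + 2m = 2m - 6; \<open>S_inv\<close> is half of it.\<close>
  then show ?thesis by (simp add: S_inv_def trace_square_mat_diff_3)
qed

lemma R_inv_eq:
  assumes "polygon 6 P" "is_lift 6 P q" "\<And>i. bracket (q (i - 1)) (q i) (q (i + 1)) \<noteq> 0"
  shows "R_inv P = 2 * S_inv P -
    (\<Sum>i = 1..6. \<Sum>j = i+1..6. \<Sum>k = j+1..6. Gamma_coeff q i j k + Gamma_coeff q i k j)"
proof -
  define \<mu> where "\<mu> = (\<Sum>i = 1..6. \<Sum>j = i+1..6. m_coeff q i j)"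
  define \<gamma> where "\<gamma> = (\<Sum>i = 1..6. \<Sum>j = i+1..6. \<Sum>k = j+1..6. Gamma_coeff q i j k + Gamma_coeff q i k j)"
  obtain K where K: "G_matrix P - mat 1 = mat 2 - K" "trace K = 6"
    "trace (K ** K) = 6 + 2 * \<mu>" "trace (K ** K ** K) = 6 + 6 * \<mu> + 3 * \<gamma>"
    unfolding \<mu>_def \<gamma>_def by (rule G_matrix_shift[OF assms])
  \<comment> \<open>Newton's identities at s = 2: the value is 48 - 144 + 6(30 -
    2\<open>\<mu>\<close>) - (120 - 24\<open>\<mu>\<close> + 6\<open>\<gamma>\<close>).\<close>
  have "6 * R_inv P = 12 * (\<mu> - 3) - 6 * \<gamma>"
    using det_mat_diff_3[of 2 K] K(2-4) by (simp add: R_inv_def K(1) algebra_simps)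
  then show ?thesis
    unfolding S_inv_eq[OF assms] \<mu>_def[symmetric] \<gamma>_def[symmetric] by simp
qed

text \<open>The bracket formulas are compared for a lift \<open>q\<close> and for its image under
  \<open>A\<close>, which is a lift of the image polygon; the two operators themselves are never
  compared.\<close>

lemma S_R_inv_projective:
  assumes P: "glick_domain 6 P" and "projective_transformation \<psi>"
  shows "S_inv (\<lambda>i. \<psi> (P i)) = S_inv P" "R_inv (\<lambda>i. \<psi> (P i)) = R_inv P"
proof -
  obtain A :: "real^3^3" where A: "invertible A" "\<And>p. p \<in> RP2 \<Longrightarrow> \<psi> p = (\<lambda>v. A *v v) ` p"
    using assms(2) unfolding projective_transformation_def by blast
  have poly: "polygon 6 P" using P by (simp add: glick_domain_def)
  obtain q where q: "is_lift 6 P q" using polygon_lift_exists[OF poly] .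
  note nz = bracket_lift_nonzero[OF P q]
  let ?q = "\<lambda>i. A *v q i"
  have nz': "bracket (?q (i - 1)) (?q i) (?q (i + 1)) \<noteq> 0" for i
    using nz[of i] A(1) by (simp add: bracket_matrix_mult invertible_det_nz)
  note poly' = polygon_projective_image[OF A poly]
  note q' = is_lift_projective_image[OF A poly q]
  show S: "S_inv (\<lambda>i. \<psi> (P i)) = S_inv P"
    using S_inv_eq[OF poly q nz] S_inv_eq[OF poly' q' nz'] unfolding m_coeff_def
    by (simp only: c_ratio_matrix_mult[OF A(1)])
  show "R_inv (\<lambda>i. \<psi> (P i)) = R_inv P"
    using R_inv_eq[OF poly q nz] R_inv_eq[OF poly' q' nz'] unfolding S Gamma_coeff_def
    by (simp only: c_ratio_matrix_mult[OF A(1)])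
qed

section \<open>Roots of a depressed cubic\<close>

lemma depressed_cubic_real_root:
  fixes S R :: real
  obtains r where "r ^ 3 - S * r - R = 0"
proof -
  define f where "f = (\<lambda>x. x ^ 3 - S * x - R)"
  \<comment> \<open>Since B is at least 1, |S|B + |R| \<le> (|S| + |R|)B \<le> B^2 \<le> B^3, so the
    cubic term decides the signs at both ends of the interval.\<close>
  define B where "B = 1 + \<bar>S\<bar> + \<bar>R\<bar>"
  have B: "\<bar>S * B + R\<bar> \<le> B ^ 3" "\<bar>S * B - R\<bar> \<le> B ^ 3"
  proof -
    have "B \<ge> 1" by (simp add: B_def)
    then have "\<bar>R\<bar> \<le> \<bar>R\<bar> * B" by (simp add: mult_le_cancel_left1)
    then have "\<bar>S\<bar> * B + \<bar>R\<bar> \<le> (\<bar>S\<bar> + \<bar>R\<bar>) * B" by (simp add: algebra_simps)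
    also have "\<dots> \<le> B * B" using \<open>B \<ge> 1\<close> by (intro mult_right_mono) (simp_all add: B_def)
    also have "\<dots> \<le> B ^ 3"
      using power_increasing[OF _ \<open>B \<ge> 1\<close>, of 2 3] by (simp add: power2_eq_square)
    finally have "\<bar>S\<bar> * B + \<bar>R\<bar> \<le> B ^ 3" .
    moreover have "\<bar>S * B\<bar> = \<bar>S\<bar> * B" using \<open>B \<ge> 1\<close> by (simp add: abs_mult)
    ultimately show "\<bar>S * B + R\<bar> \<le> B ^ 3" "\<bar>S * B - R\<bar> \<le> B ^ 3" by linarith+
  qed
  have "f (- B) \<le> 0" "0 \<le> f B" "- B \<le> B"
    using B by (auto simp: f_def abs_le_iff) (simp add: B_def)
  moreover have "continuous_on {- B..B} f"
    unfolding f_def by (intro continuous_intros)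
  ultimately obtain r where "f r = 0" using IVT'[of f "- B" 0 B] by blast
  then show thesis using that by (simp add: f_def)
qed

text \<open>Dividing by z - r leaves z^2 + rz + r^2 - S, whose discriminant is 4S - 3r^2 and whose
  value at r is 3r^2 - S. The discriminant of the cubic is the former times the square of the
  latter.\<close>

lemma depressed_cubic_disc_root:
  fixes S R r :: "'a::idom"
  assumes "r ^ 3 - S * r - R = 0"
  shows "4 * S ^ 3 - 27 * R ^ 2 = (4 * S - 3 * r\<^sup>2) * (3 * r\<^sup>2 - S)\<^sup>2"
proof -
  have "R = r ^ 3 - S * r" using assms by (simp add: algebra_simps)
  then show ?thesis by algebra
qed

text \<open>Applied over the reals to separate eigenvalues, and over the complex numbers when a
  double eigenvalue is given and the third one is only known to be complex.\<close>

lemma depressed_cubic_disc: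
  fixes a b c S R :: "'a::idom"
  assumes "a + b + c = 0" "a * b + b * c + c * a = - S" "a * b * c = R"
  shows "4 * S ^ 3 - 27 * R ^ 2 = ((a - b) * (b - c) * (c - a))\<^sup>2"
proof -
  have "c = - a - b" using assms(1) by algebra
  moreover from this have "S = a\<^sup>2 + a * b + b\<^sup>2" using assms(2) by algebra
  ultimately show ?thesis using assms(3) by algebra
qed

text \<open>Isolates what the case analysis uses about the spectrum. The polynomial is given by its
  values, which determine it over an infinite field.\<close>

locale shifted_cubic =
  fixes Sp :: "complex multiset" and S R :: real
  assumes roots: "\<exists>p. Sp = proots p \<and>
    (\<forall>z. poly p z = (z - 1) ^ 3 - of_real S * (z - 1) - of_real R)"
begin

lemma Sp_eq:
  assumes "a + b + c = 0" "a * b + b * c + c * a = - of_real S" "a * b * c = of_real R"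
  shows "Sp = {#1 + a, 1 + b, 1 + c#}"
proof -
  obtain p where p: "Sp = proots p" "\<And>z. poly p z = (z - 1) ^ 3 - of_real S * (z - 1) - of_real R"
    using roots by blast
  define f where "f = [:- (1 + a), 1:] * ([:- (1 + b), 1:] * [:- (1 + c), 1:])"
  have "poly p z = poly f z" for z
  proof -
    have "of_real S = - (a * b + b * c + c * a)" using assms(2) by simp
    then have "poly p z = (z - 1 - a) * ((z - 1 - b) * (z - 1 - c))"
      unfolding p(2) assms(3)[symmetric] using assms(1) by algebra
    then show ?thesis by (simp add: f_def algebra_simps)
  qed
  then have "p = f" by (simp add: poly_eq_poly_eq_iff[symmetric] fun_eq_iff)
  \<comment> \<open>The rules multiplying out \<open>pCons\<close> are withheld so that the linear
    factors survive for \<open>proots_mult\<close>.\<close>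
  then show ?thesis
    unfolding p(1) by (simp add: f_def proots_mult proots_linear_factor add_ac add_mset_commute
        del: mult_pCons_left mult_pCons_right)
qed

text \<open>After splitting off a real root, the quadratic formula with a complex square root covers
  every sign of the discriminant at once.\<close>

lemma roots_exist:
  obtains r w :: complex where "r \<in> \<real>" "r ^ 3 - of_real S * r - of_real R = 0"
    "Sp = {#1 + r, 1 + (- r / 2 + w), 1 + (- r / 2 - w)#}" "w\<^sup>2 = of_real S - 3 * r\<^sup>2 / 4"
proof -
  obtain x where x: "x ^ 3 - S * x - R = 0" by (rule depressed_cubic_real_root)
  define r where "r = complex_of_real x"
  define w where "w = csqrt (of_real S - 3 * r\<^sup>2 / 4)"
  have r: "r ^ 3 - of_real S * r - of_real R = 0"
    using arg_cong[OF x, of complex_of_real] by (simp add: r_def)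
  have w: "w\<^sup>2 = of_real S - 3 * r\<^sup>2 / 4" by (simp add: w_def)
  have "Sp = {#1 + r, 1 + (- r / 2 + w), 1 + (- r / 2 - w)#}"
  proof (rule Sp_eq)
    show "r + (- r / 2 + w) + (- r / 2 - w) = 0" by simp
    have "r * (- r / 2 + w) + (- r / 2 + w) * (- r / 2 - w) + (- r / 2 - w) * r = - (3 * r\<^sup>2 / 4) - w\<^sup>2"
      by (simp add: algebra_simps power2_eq_square)
    then show "r * (- r / 2 + w) + (- r / 2 + w) * (- r / 2 - w) + (- r / 2 - w) * r = - of_real S"
      by (simp add: w)
    have "r * (- r / 2 + w) * (- r / 2 - w) = r * (r\<^sup>2 / 4 - w\<^sup>2)"
      by (simp add: algebra_simps power2_eq_square)
    also have "\<dots> = r ^ 3 - of_real S * r"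
      unfolding w by (simp add: field_simps power2_eq_square power3_eq_cube)
    finally show "r * (- r / 2 + w) * (- r / 2 - w) = of_real R" using r by simp
  qed
  then show thesis using that r w by (metis Reals_of_real r_def)
qed

text \<open>Converse of \<open>Sp_eq\<close>. Equal multisets do not tell which of a, b, c is the
  root r, but sums of (z - 1)^k over the multiset ignore the order. For k = 1, 2, 3 they are 0, 2S,
  3R, which fixes the elementary symmetric functions.\<close>

lemma symmetric_functions:
  assumes "Sp = {#1 + a, 1 + b, 1 + c#}"
  shows "a + b + c = 0" "a * b + b * c + c * a = - of_real S" "a * b * c = of_real R"
proof -
  obtain r w :: complex where rw: "r ^ 3 - of_real S * r - of_real R = 0"
    "Sp = {#1 + r, 1 + (- r / 2 + w), 1 + (- r / 2 - w)#}" "w\<^sup>2 = of_real S - 3 * r\<^sup>2 / 4"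
    by (rule roots_exist)
  have sym: "\<Sum>\<^sub># (image_mset f {#1 + a, 1 + b, 1 + c#}) =
      \<Sum>\<^sub># (image_mset f {#1 + r, 1 + (- r / 2 + w), 1 + (- r / 2 - w)#})" for f :: "complex \<Rightarrow> complex"
    using assms rw(2) by simp
  show s: "a + b + c = 0"
    using sym[of "\<lambda>z. z - 1"] by (simp add: add.assoc)
  have "a\<^sup>2 + (b\<^sup>2 + c\<^sup>2) = r\<^sup>2 + ((- r / 2 + w)\<^sup>2 + (- r / 2 - w)\<^sup>2)"
    using sym[of "\<lambda>z. (z - 1)\<^sup>2"] by simp
  also have "\<dots> = 3 * r\<^sup>2 / 2 + 2 * w\<^sup>2"
    by (simp add: algebra_simps power2_eq_square)
  also have "\<dots> = 2 * of_real S" by (simp add: rw(3))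
  finally have s2: "a\<^sup>2 + (b\<^sup>2 + c\<^sup>2) = 2 * of_real S" .
  have "2 * (a * b + b * c + c * a) = (a + b + c)\<^sup>2 - (a\<^sup>2 + (b\<^sup>2 + c\<^sup>2))" by algebra
  then have "2 * (a * b + b * c + c * a) = 2 * (- of_real S)" by (simp add: s s2)
  then show "a * b + b * c + c * a = - of_real S" by (simp only: mult_cancel_left) simp
  have "a ^ 3 + (b ^ 3 + c ^ 3) = r ^ 3 + ((- r / 2 + w) ^ 3 + (- r / 2 - w) ^ 3)"
    using sym[of "\<lambda>z. (z - 1) ^ 3"] by simp
  also have "\<dots> = 3 * r ^ 3 / 4 - 3 * r * w\<^sup>2"
    by (simp add: field_simps power2_eq_square power3_eq_cube)
  also have "\<dots> = 3 * (r ^ 3 - of_real S * r)"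
    unfolding rw(3) by (simp add: field_simps power2_eq_square power3_eq_cube)
  also have "r ^ 3 - of_real S * r = of_real R" using rw(1) by simp
  finally have "a ^ 3 + (b ^ 3 + c ^ 3) = 3 * of_real R" .
  moreover have "a ^ 3 + (b ^ 3 + c ^ 3) = 3 * (a * b * c)" using s by algebra
  ultimately show "a * b * c = of_real R" by simp
qed

lemma size_Sp: "size Sp = 3"
  by (rule roots_exist) simp

lemma real_symmetric_functions:
  fixes a b c :: real
  assumes "Sp = {#of_real (1 + a), of_real (1 + b), of_real (1 + c)#}"
  shows "a + b + c = 0" "a * b + b * c + c * a = - S" "a * b * c = R"
proof -
  have "Sp = {#1 + of_real a, 1 + of_real b, 1 + of_real c#}" using assms by simp
  note * = symmetric_functions[OF this]
  have "complex_of_real (a + b + c) = of_real 0" using *(1) by simp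
  then show "a + b + c = 0" by (simp only: of_real_eq_iff)
  have "complex_of_real (a * b + b * c + c * a) = of_real (- S)" using *(2) by simp
  then show "a * b + b * c + c * a = - S" by (simp only: of_real_eq_iff)
  have "complex_of_real (a * b * c) = of_real R" using *(3) by simp
  then show "a * b * c = R" by (simp only: of_real_eq_iff)
qed

lemma Sp_eq_real:
  fixes a b c :: real
  assumes "a + b + c = 0" "a * b + b * c + c * a = - S" "a * b * c = R"
  shows "Sp = {#of_real (1 + a), of_real (1 + b), of_real (1 + c)#}"
  using Sp_eq[of "of_real a" "of_real b" "of_real c"] assms
  by (simp flip: of_real_add of_real_mult of_real_minus) simp

section \<open>Sign of the discriminant and type of the spectrum\<close>

abbreviation "\<Delta> \<equiv> 4 * S ^ 3 - 27 * R ^ 2"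

text \<open>Both forms of the discriminant are used: the one with a single root r makes 4S - 3r^2
  positive, hence the other two roots real; the product of differences shows that all three are
  distinct.\<close>

lemma disc_pos_iff:
  "\<Delta> > 0 \<longleftrightarrow> (\<exists>x y z :: real. x \<noteq> y \<and> x \<noteq> z \<and> y \<noteq> z \<and> Sp = {#of_real x, of_real y, of_real z#})"
proof
  assume pos: "\<Delta> > 0"
  obtain r where r: "r ^ 3 - S * r - R = 0" by (rule depressed_cubic_real_root)
  have "4 * S - 3 * r\<^sup>2 > 0"
    using pos unfolding depressed_cubic_disc_root[OF r] by (simp add: zero_less_mult_iff)
  define w where "w = sqrt (S - 3 * r\<^sup>2 / 4)"
  have w: "w\<^sup>2 = S - 3 * r\<^sup>2 / 4" using \<open>4 * S - 3 * r\<^sup>2 > 0\<close> by (simp add: w_def)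
  define b c where "b = - r / 2 + w" and "c = - r / 2 - w"
  have eqs: "r + b + c = 0" "r * b + b * c + c * r = - S" "r * b * c = R"
  proof -
    show "r + b + c = 0" by (simp add: b_def c_def)
    have "r * b + b * c + c * r = - (3 * r\<^sup>2 / 4) - w\<^sup>2"
      by (simp add: b_def c_def algebra_simps power2_eq_square)
    then show "r * b + b * c + c * r = - S" by (simp add: w)
    have "r * b * c = r * (r\<^sup>2 / 4 - w\<^sup>2)"
      by (simp add: b_def c_def algebra_simps power2_eq_square)
    also have "\<dots> = r ^ 3 - S * r"
      unfolding w by (simp add: field_simps power2_eq_square power3_eq_cube)
    finally show "r * b * c = R" using r by simp
  qed
  have "r \<noteq> b" "r \<noteq> c" "b \<noteq> c"
    using pos unfolding depressed_cubic_disc[OF eqs] by auto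
  then show "\<exists>x y z :: real. x \<noteq> y \<and> x \<noteq> z \<and> y \<noteq> z \<and> Sp = {#of_real x, of_real y, of_real z#}"
    using Sp_eq_real[OF eqs] by (intro exI[of _ "1 + r"] exI[of _ "1 + b"] exI[of _ "1 + c"]) simp
next
  assume "\<exists>x y z :: real. x \<noteq> y \<and> x \<noteq> z \<and> y \<noteq> z \<and> Sp = {#of_real x, of_real y, of_real z#}"
  then obtain x y z :: real where ne: "x \<noteq> y" "x \<noteq> z" "y \<noteq> z"
    and Sp: "Sp = {#of_real x, of_real y, of_real z#}" by blast
  have "Sp = {#of_real (1 + (x - 1)), of_real (1 + (y - 1)), of_real (1 + (z - 1))#}"
    using Sp by simp
  from depressed_cubic_disc[OF real_symmetric_functions[OF this]] ne
  show "\<Delta> > 0" by simp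
qed

lemma disc_zero_param:
  assumes "\<Delta> = 0"
  shows "\<exists>!s. S = 3 * s\<^sup>2 \<and> R = 2 * s ^ 3"
proof (rule ex_ex1I)
  show "\<exists>s. S = 3 * s\<^sup>2 \<and> R = 2 * s ^ 3"
  proof (cases "S = 0")
    case True
    with assms have "R = 0" by simp
    with True show ?thesis by (intro exI[of _ 0]) simp
  next
    case False
    \<comment> \<open>Dividing R = 2s^3 by S = 3s^2 gives the witness s = 3R/(2S).\<close>
    have *: "27 * R\<^sup>2 = 4 * S ^ 3" using assms by simp
    have "3 * (3 * R / (2 * S))\<^sup>2 = 27 * R\<^sup>2 / (4 * S\<^sup>2)"
      by (simp add: power_divide power_mult_distrib)
    also have "\<dots> = S" unfolding * using False by (simp add: power3_eq_cube power2_eq_square)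
    finally have "S = 3 * (3 * R / (2 * S))\<^sup>2" by simp
    moreover have "2 * (3 * R / (2 * S)) ^ 3 = 27 * R\<^sup>2 * R / (4 * S ^ 3)"
      by (simp add: power_divide power_mult_distrib power3_eq_cube power2_eq_square)
    then have "R = 2 * (3 * R / (2 * S)) ^ 3" using False by (simp add: *)
    ultimately show ?thesis by blast
  qed
next
  fix s t assume *: "S = 3 * s\<^sup>2 \<and> R = 2 * s ^ 3" "S = 3 * t\<^sup>2 \<and> R = 2 * t ^ 3"
  \<comment> \<open>S fixes s only up to sign; R fixes it completely, cubing being injective on the
    reals.\<close>
  then have "s ^ 3 = t ^ 3" by simp
  then have "root 3 (s ^ 3) = root 3 (t ^ 3)" by simp
  then show "s = t" by (simp add: odd_real_root_power_cancel)
qed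

lemma Sp_eq_if_param:
  assumes "S = 3 * s\<^sup>2" "R = 2 * s ^ 3"
  shows "Sp = {#of_real (1 + 2 * s), of_real (1 - s), of_real (1 - s)#}"
  using Sp_eq_real[of "2 * s" "- s" "- s"] assms
  by (simp add: algebra_simps power2_eq_square power3_eq_cube)

lemma Sp_eq_1_1_1_iff:
  assumes "S = 3 * s\<^sup>2" "R = 2 * s ^ 3"
  shows "s = 0 \<longleftrightarrow> Sp = {#1, 1, 1#}"
proof
  assume "s = 0"
  then show "Sp = {#1, 1, 1#}" using Sp_eq_if_param[OF assms] by simp
next
  assume "Sp = {#1, 1, 1#}"
  then have "S = 0" using symmetric_functions(2)[of 0 0 0] by simp
  then show "s = 0" using assms by simp
qed

lemma disc_zero_iff: "\<Delta> = 0 \<longleftrightarrow> (\<exists>x :: real. count Sp (of_real x) \<ge> 2)"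
proof
  assume "\<Delta> = 0"
  then obtain s where "S = 3 * s\<^sup>2" "R = 2 * s ^ 3" using disc_zero_param by blast
  then have "Sp = {#of_real (1 + 2 * s), of_real (1 - s), of_real (1 - s)#}"
    by (rule Sp_eq_if_param)
  then have "count Sp (of_real (1 - s)) \<ge> 2" by simp
  then show "\<exists>x :: real. count Sp (of_real x) \<ge> 2" ..
next
  assume "\<exists>x :: real. count Sp (of_real x) \<ge> 2"
  then obtain x :: real where "count Sp (of_real x) \<ge> 2" ..
  \<comment> \<open>Two copies of x split off and the size 3 leaves one complex number y. Two equal
    roots annihilate the product of differences.\<close>
  then have "replicate_mset 2 (complex_of_real x) \<subseteq># Sp" by (simp add: count_le_replicate_mset_subset_eq)
  then obtain N where N: "Sp = replicate_mset 2 (of_real x) + N"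
    unfolding mset_subset_eq_exists_conv by blast
  then have "size N = 1" using size_Sp by simp
  then obtain y where "N = {#y#}" using size_1_singleton_mset by blast
  with N have "Sp = {#1 + (of_real x - 1), 1 + (of_real x - 1), 1 + (y - 1)#}"
    by (simp add: numeral_2_eq_2)
  from depressed_cubic_disc[OF symmetric_functions[OF this]]
  have "complex_of_real \<Delta> = 0" by simp
  then show "\<Delta> = 0" by (simp only: of_real_eq_0_iff)
qed

lemma disc_neg_root_unique:
  assumes "\<Delta> < 0"
  shows "\<exists>!r. r ^ 3 - S * r - R = 0"
proof (rule ex_ex1I)
  show "\<exists>r. r ^ 3 - S * r - R = 0" using depressed_cubic_real_root by blast
next
  fix r t assume r: "r ^ 3 - S * r - R = 0" and t: "t ^ 3 - S * t - R = 0"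
  have neg: "4 * S - 3 * r\<^sup>2 < 0"
    using assms unfolding depressed_cubic_disc_root[OF r] by (simp add: mult_less_0_iff)
  \<comment> \<open>Completing the square: the cofactor of t - r in the difference of the two
    equations is positive, so t = r.\<close>
  have "4 * (t\<^sup>2 + r * t + r\<^sup>2) - 4 * S = (2 * t + r)\<^sup>2 - (4 * S - 3 * r\<^sup>2)"
    by algebra
  then have "t\<^sup>2 + r * t + r\<^sup>2 - S > 0" using neg by (smt (verit) zero_le_power2)
  moreover have "(t - r) * (t\<^sup>2 + r * t + r\<^sup>2 - S) = 0" using r t by algebra
  ultimately show "r = t" by simp
qed

lemma disc_neg_root:
  assumes "\<Delta> < 0" "r ^ 3 - S * r - R = 0"
  defines "\<omega> \<equiv> sqrt (3 * r\<^sup>2 / 4 - S)"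
  shows "\<omega> > 0" and "\<omega>\<^sup>2 = 3 * r\<^sup>2 / 4 - S"
    and "Sp = {#of_real (1 + r), of_real (1 - r / 2) + \<i> * of_real \<omega>,
      of_real (1 - r / 2) - \<i> * of_real \<omega>#}"
proof -
  have neg: "4 * S - 3 * r\<^sup>2 < 0"
    using assms(1) unfolding depressed_cubic_disc_root[OF assms(2)] by (simp add: mult_less_0_iff)
  then show "\<omega> > 0" "\<omega>\<^sup>2 = 3 * r\<^sup>2 / 4 - S" by (simp_all add: \<omega>_def)
  note w = this(2)
  \<comment> \<open>The roots of z^2 + rz + r^2 - S, written with \<open>Complex\<close> so that
    Vieta's relations split into real and imaginary parts.\<close>
  let ?b = "Complex (- r / 2) \<omega>" and ?c = "Complex (- r / 2) (- \<omega>)"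
  have "Sp = {#1 + of_real r, 1 + ?b, 1 + ?c#}"
  proof (rule Sp_eq)
    show "of_real r + ?b + ?c = 0" by (simp add: complex_eq_iff)
    have "r * r / 4 + \<omega> * \<omega> - r * r = - S"
      using w by (simp add: power2_eq_square)
    then show "of_real r * ?b + ?b * ?c + ?c * of_real r = - of_real S"
      by (simp add: complex_eq_iff)
    have "r * r / 4 + \<omega> * \<omega> = r * r - S"
      using w by (simp add: power2_eq_square)
    then have "r * (r * r / 4 + \<omega> * \<omega>) = r ^ 3 - S * r"
      by (simp only:) (simp add: power3_eq_cube algebra_simps)
    also have "\<dots> = R" using assms(2) by simp
    finally have "r * (r * r / 4 + \<omega> * \<omega>) = R" .
    then show "of_real r * ?b * ?c = of_real R"
      by (simp add: complex_eq_iff algebra_simps)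
  qed
  moreover have "1 + ?b = of_real (1 - r / 2) + \<i> * of_real \<omega>"
    "1 + ?c = of_real (1 - r / 2) - \<i> * of_real \<omega>"
    by (simp_all add: complex_eq_iff)
  ultimately show "Sp = {#of_real (1 + r), of_real (1 - r / 2) + \<i> * of_real \<omega>,
      of_real (1 - r / 2) - \<i> * of_real \<omega>#}"
    by (simp only: of_real_add of_real_1)
qed

lemma disc_neg_iff:
  "\<Delta> < 0 \<longleftrightarrow> (\<exists>(x :: real) z. z \<notin> \<real> \<and> Sp = {#of_real x, z, cnj z#})"
proof
  assume neg: "\<Delta> < 0"
  obtain r where r: "r ^ 3 - S * r - R = 0" by (rule depressed_cubic_real_root)
  define \<omega> where "\<omega> = sqrt (3 * r\<^sup>2 / 4 - S)"
  define z where "z = of_real (1 - r / 2) + \<i> * of_real \<omega>"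
  note * = disc_neg_root[OF neg r, folded \<omega>_def]
  have "z \<notin> \<real>" using *(1) by (simp add: z_def complex_is_Real_iff)
  moreover have "Sp = {#of_real (1 + r), z, cnj z#}"
    using *(3) by (simp add: z_def)
  ultimately show "\<exists>(x :: real) z. z \<notin> \<real> \<and> Sp = {#of_real x, z, cnj z#}" by blast
next
  assume "\<exists>(x :: real) z. z \<notin> \<real> \<and> Sp = {#of_real x, z, cnj z#}"
  then obtain x :: real and z where z: "z \<notin> \<real>" and Sp: "Sp = {#of_real x, z, cnj z#}" by blast
  define r u v where "r = x - 1" and "u = Re z - 1" and "v = Im z"
  have "v \<noteq> 0" using z by (simp add: v_def complex_is_Real_iff)
  have "of_real x = 1 + of_real r" "z = 1 + Complex u v" "cnj z = 1 + Complex u (- v)"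
    by (simp_all add: r_def u_def v_def complex_eq_iff)
  with Sp have "Sp = {#1 + of_real r, 1 + Complex u v, 1 + Complex u (- v)#}" by simp
  note * = symmetric_functions[OF this]
  have 1: "r = - 2 * u" using *(1) by (simp add: complex_eq_iff)
  have 2: "S = - (r * u + (u * u + v * v) + u * r)" using *(2) by (simp add: complex_eq_iff)
  have 3: "R = r * (u * u + v * v)" using *(3) by (simp add: complex_eq_iff algebra_simps)
  have S: "S = 3 * u\<^sup>2 - v\<^sup>2" unfolding 2 1 by algebra
  have "r ^ 3 - S * r - R = 0" unfolding S 3 1 by algebra
  \<comment> \<open>For r = -2u and S = 3u^2 - v^2 the factors 4S - 3r^2 and 3r^2 - S become -4v^2
    and 9u^2 + v^2.\<close>
  from depressed_cubic_disc_root[OF this]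
  have "\<Delta> = - (4 * v\<^sup>2 * (9 * u\<^sup>2 + v\<^sup>2)\<^sup>2)" unfolding S 1 by algebra
  moreover have "4 * v\<^sup>2 * (9 * u\<^sup>2 + v\<^sup>2)\<^sup>2 > 0"
  proof -
    have "v\<^sup>2 > 0" using \<open>v \<noteq> 0\<close> by simp
    moreover have "9 * u\<^sup>2 + v\<^sup>2 > 0" using \<open>v\<^sup>2 > 0\<close> by (simp add: add_nonneg_pos)
    ultimately show ?thesis by simp
  qed
  ultimately show "\<Delta> < 0" by linarith
qed

section \<open>Real eigenvalues of equal modulus\<close>

lemma cmod_eq_locus:
  assumes "R = 8 - 2 * S" "S > 3"
  shows "Sp = {#3, of_real (sqrt (S - 3)), - of_real (sqrt (S - 3))#}"
proof -
  define w where "w = sqrt (S - 3)"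
  have "w\<^sup>2 = S - 3" using assms by (simp add: w_def)
  then have S: "S = w\<^sup>2 + 3" by simp
  \<comment> \<open>R = 8 - 2S says that 2 is a root of the depressed cubic. The cofactor z^2 + 2z +
    4 - S has roots -1 + w and -1 - w, and adding 1 makes them opposite.\<close>
  have "Sp = {#of_real (1 + 2), of_real (1 + (w - 1)), of_real (1 + (- w - 1))#}"
    by (rule Sp_eq_real) (simp_all add: assms(1) S algebra_simps power2_eq_square)
  then show ?thesis by (simp add: w_def)
qed

text \<open>Distinct real eigenvalues of equal modulus are opposite; as the trace is \<open>3\<close>,
  the remaining eigenvalue is then \<open>3\<close>.\<close>

lemma opposite_eigenvalues_locus:
  fixes x y z :: real
  assumes Sp: "Sp = {#of_real x, of_real y, of_real z#}"
    and "y \<noteq> x" "z \<noteq> x" "z \<noteq> y" "y = - x"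
  shows "R = 8 - 2 * S \<and> S > 3 \<and> S \<noteq> 12"
proof -
  have "Sp = {#of_real (1 + (x - 1)), of_real (1 + (y - 1)), of_real (1 + (z - 1))#}"
    using Sp by simp
  note * = real_symmetric_functions[OF this]
  have z: "z = 3" using *(1) \<open>y = - x\<close> by simp
  have S: "S = x\<^sup>2 + 3" using *(2) unfolding z \<open>y = - x\<close> by algebra
  have "R = 8 - 2 * S" unfolding *(3)[symmetric] S z \<open>y = - x\<close> by algebra
  \<comment> \<open>Distinctness gives the two side conditions: x and -x differ, so S > 3; the
    eigenvalue 3 is neither x nor -x, so S is not 12.\<close>
  moreover have "x \<noteq> 0" using assms by auto
  moreover have "x\<^sup>2 \<noteq> 3\<^sup>2" using assms z unfolding power2_eq_iff by auto
  ultimately show ?thesis using S by auto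
qed

text \<open>Distinct reals of equal modulus are opposite. Whichever pair it is, permuting the
  multiset moves it to the front, where \<open>opposite_eigenvalues_locus\<close> applies.\<close>

lemma cmod_eq_iff:
  assumes "\<exists>x y z :: real. x \<noteq> y \<and> x \<noteq> z \<and> y \<noteq> z \<and> Sp = {#of_real x, of_real y, of_real z#}"
  shows "(\<exists>z w. z \<in># Sp \<and> w \<in># Sp \<and> z \<noteq> w \<and> cmod z = cmod w) \<longleftrightarrow>
    R = 8 - 2 * S \<and> S > 3 \<and> S \<noteq> 12"
proof
  assume "\<exists>z w. z \<in># Sp \<and> w \<in># Sp \<and> z \<noteq> w \<and> cmod z = cmod w"
  then obtain u v where uv: "u \<in># Sp" "v \<in># Sp" "u \<noteq> v" "cmod u = cmod v" by blast
  from assms obtain x y z :: real where ne: "x \<noteq> y" "x \<noteq> z" "y \<noteq> z"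
    and Sp: "Sp = {#of_real x, of_real y, of_real z#}" by blast
  have "\<bar>x\<bar> = \<bar>y\<bar> \<or> \<bar>x\<bar> = \<bar>z\<bar> \<or> \<bar>y\<bar> = \<bar>z\<bar>"
    using uv by (auto simp: Sp)
  then consider "y = - x" | "z = - x" | "z = - y"
    using ne by (auto simp: abs_eq_iff)
  then show "R = 8 - 2 * S \<and> S > 3 \<and> S \<noteq> 12"
  proof cases
    case 1
    then show ?thesis using opposite_eigenvalues_locus[OF Sp] ne by simp
  next
    case 2
    have "Sp = {#of_real x, of_real z, of_real y#}" by (simp add: Sp add_mset_commute)
    from opposite_eigenvalues_locus[OF this] 2 ne show ?thesis by simp
  next
    case 3
    have "Sp = {#of_real y, of_real z, of_real x#}" by (simp add: Sp add_mset_commute)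
    from opposite_eigenvalues_locus[OF this] 3 ne show ?thesis by simp
  qed
next
  assume *: "R = 8 - 2 * S \<and> S > 3 \<and> S \<noteq> 12"
  define w where "w = complex_of_real (sqrt (S - 3))"
  have Sp: "Sp = {#3, w, - w#}" using cmod_eq_locus * by (simp add: w_def)
  moreover have "w \<noteq> 0" using * by (simp add: w_def)
  ultimately show "\<exists>z w. z \<in># Sp \<and> w \<in># Sp \<and> z \<noteq> w \<and> cmod z = cmod w"
    by (intro exI[of _ w] exI[of _ "- w"]) simp
qed

end

theorem proposition5p18:
  fixes P :: "int \<Rightarrow> (real^3) set"
  assumes "glick_domain 6 P"
  shows
    "(\<forall>\<psi>. projective_transformation \<psi> \<longrightarrow>
        S_inv (\<lambda>i. \<psi> (P i)) = S_inv P \<and> R_inv (\<lambda>i. \<psi> (P i)) = R_inv P) \<and>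
     (\<forall>t. poly (charpoly (G_matrix P)) t = (t - 1) ^ 3 - S_inv P * (t - 1) - R_inv P) \<and>
     (\<forall>q. is_lift 6 P q \<longrightarrow>
        S_inv P = (\<Sum>i = 1..6. \<Sum>j = i+1..6. m_coeff q i j) - 3 \<and>
        R_inv P = 2 * S_inv P -
          (\<Sum>i = 1..6. \<Sum>j = i+1..6. \<Sum>k = j+1..6. Gamma_coeff q i j k + Gamma_coeff q i k j)) \<and>
     \<comment> \<open>(i)\<close>
     (Delta P > 0 \<longleftrightarrow> three_distinct_real_eigenvalues (G_matrix P)) \<and>
     \<comment> \<open>(ii)\<close>
     (Delta P = 0 \<longleftrightarrow> has_repeated_real_eigenvalue (G_matrix P)) \<and>
     (Delta P = 0 \<longrightarrow>
        (\<exists>!s::real. S_inv P = 3 * s\<^sup>2 \<and> R_inv P = 2 * s ^ 3 \<and>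
           spectrum (G_matrix P) = {#of_real (1 + 2 * s), of_real (1 - s), of_real (1 - s)#}) \<and>
        (\<forall>s::real. S_inv P = 3 * s\<^sup>2 \<and> R_inv P = 2 * s ^ 3 \<and>
           spectrum (G_matrix P) = {#of_real (1 + 2 * s), of_real (1 - s), of_real (1 - s)#} \<longrightarrow>
           (s = 0 \<longleftrightarrow> spectrum (G_matrix P) = {#1, 1, 1#}))) \<and>
     \<comment> \<open>(iii)\<close>
     (Delta P < 0 \<longleftrightarrow> has_nonreal_conjugate_pair (G_matrix P)) \<and>
     (Delta P < 0 \<longrightarrow>
        (\<exists>!r::real. r ^ 3 - S_inv P * r - R_inv P = 0) \<and>
        (\<forall>r \<omega> :: real. r ^ 3 - S_inv P * r - R_inv P = 0 \<longrightarrow> \<omega> = sqrt (3 * r\<^sup>2 / 4 - S_inv P) \<longrightarrow>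
           \<omega> > 0 \<and>
           spectrum (G_matrix P) =
             {#of_real (1 + r), of_real (1 - r / 2) + \<i> * of_real \<omega>,
               of_real (1 - r / 2) - \<i> * of_real \<omega>#} \<and>
           \<bar>1 + r\<bar>\<^sup>2 - (cmod (of_real (1 - r / 2) + \<i> * of_real \<omega>))\<^sup>2 = 3 * r + S_inv P \<and>
           (3 * r + S_inv P > 0 \<longleftrightarrow>
              \<bar>1 + r\<bar> > cmod (of_real (1 - r / 2) + \<i> * of_real \<omega>)) \<and>
           (3 * r + S_inv P = 0 \<longleftrightarrow>
              \<bar>1 + r\<bar> = cmod (of_real (1 - r / 2) + \<i> * of_real \<omega>)) \<and>
           (3 * r + S_inv P < 0 \<longleftrightarrow>
              \<bar>1 + r\<bar> < cmod (of_real (1 - r / 2) + \<i> * of_real \<omega>)))) \<and>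
     \<comment> \<open>(iv)\<close>
     (three_distinct_real_eigenvalues (G_matrix P) \<longrightarrow>
        ((\<exists>z w. z \<in># spectrum (G_matrix P) \<and> w \<in># spectrum (G_matrix P) \<and>
            z \<noteq> w \<and> cmod z = cmod w) \<longleftrightarrow>
         R_inv P = 8 - 2 * S_inv P \<and> S_inv P > 3 \<and> S_inv P \<noteq> 12) \<and>
        (R_inv P = 8 - 2 * S_inv P \<and> S_inv P > 3 \<and> S_inv P \<noteq> 12 \<longrightarrow>
           spectrum (G_matrix P) =
             {#3, of_real (sqrt (S_inv P - 3)), - of_real (sqrt (S_inv P - 3))#} \<and>
           (S_inv P < 12 \<longrightarrow> dominant_eigenvalues (G_matrix P) = {3}) \<and>
           (S_inv P > 12 \<longrightarrow> dominant_eigenvalues (G_matrix P) =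
              {of_real (sqrt (S_inv P - 3)), - of_real (sqrt (S_inv P - 3))})))"
proof -
  define G where "G = G_matrix P"
  define S where "S = S_inv P"
  define R where "R = R_inv P"
  have poly: "polygon 6 P" using assms by (simp add: glick_domain_def)
  obtain q where q: "is_lift 6 P q" using polygon_lift_exists[OF poly] .
  have tr: "trace (G - mat 1) = 0"
    unfolding G_def by (rule trace_G_matrix_shift[OF poly q bracket_lift_nonzero[OF assms q]])
  \<comment> \<open>Over the reals the embedding is the identity, so the generic lemma speaks about
    \<open>charpoly G\<close> itself.\<close>
  have "map_matrix of_real G = G" by (simp add: vec_eq_iff)
  then have charpoly: "poly (charpoly G) t = (t - 1) ^ 3 - S * (t - 1) - R" for t
    using poly_charpoly_of_real_3[OF tr, of t] by (simp add: S_def R_def S_inv_def R_inv_def G_def)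
  have "\<exists>p. spectrum G = proots p \<and>
      (\<forall>z. poly p z = (z - 1) ^ 3 - of_real S * (z - 1) - of_real R)"
    unfolding spectrum_def S_def R_def S_inv_def R_inv_def G_def[symmetric]
    using poly_charpoly_of_real_3[OF tr, where 'a = complex] by blast
  then interpret shifted_cubic "spectrum G" S R by unfold_locales
  have Delta: "Delta P = 4 * S ^ 3 - 27 * R ^ 2" by (simp add: Delta_def S_def R_def)
  have i: "Delta P > 0 \<longleftrightarrow> three_distinct_real_eigenvalues G"
    unfolding Delta three_distinct_real_eigenvalues_def by (rule disc_pos_iff)
  have ii: "Delta P = 0 \<longleftrightarrow> has_repeated_real_eigenvalue G"
    unfolding Delta has_repeated_real_eigenvalue_def by (rule disc_zero_iff)
  have ii': "(\<exists>!s::real. S = 3 * s\<^sup>2 \<and> R = 2 * s ^ 3 \<and>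
        spectrum G = {#of_real (1 + 2 * s), of_real (1 - s), of_real (1 - s)#}) \<and>
      (\<forall>s::real. S = 3 * s\<^sup>2 \<and> R = 2 * s ^ 3 \<and>
        spectrum G = {#of_real (1 + 2 * s), of_real (1 - s), of_real (1 - s)#} \<longrightarrow>
        (s = 0 \<longleftrightarrow> spectrum G = {#1, 1, 1#}))" if "Delta P = 0"
  proof (intro conjI allI impI)
    \<comment> \<open>The spectrum clause follows from the two equations, so existence and
      uniqueness carry over from \<open>disc_zero_param\<close>.\<close>
    have "(S = 3 * s\<^sup>2 \<and> R = 2 * s ^ 3 \<and>
        spectrum G = {#of_real (1 + 2 * s), of_real (1 - s), of_real (1 - s)#}) \<longleftrightarrow>
      S = 3 * s\<^sup>2 \<and> R = 2 * s ^ 3" for s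
      using Sp_eq_if_param by blast
    then show "\<exists>!s::real. S = 3 * s\<^sup>2 \<and> R = 2 * s ^ 3 \<and>
        spectrum G = {#of_real (1 + 2 * s), of_real (1 - s), of_real (1 - s)#}"
      using disc_zero_param that unfolding Delta by simp
  qed (use Sp_eq_1_1_1_iff in blast)
  have iii: "Delta P < 0 \<longleftrightarrow> has_nonreal_conjugate_pair G"
    unfolding Delta has_nonreal_conjugate_pair_def by (rule disc_neg_iff)
  have iii': "\<omega> > 0 \<and>
      spectrum G = {#of_real (1 + r), of_real (1 - r / 2) + \<i> * of_real \<omega>,
        of_real (1 - r / 2) - \<i> * of_real \<omega>#} \<and>
      \<bar>1 + r\<bar>\<^sup>2 - (cmod (of_real (1 - r / 2) + \<i> * of_real \<omega>))\<^sup>2 = 3 * r + S \<and>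
      (3 * r + S > 0 \<longleftrightarrow> \<bar>1 + r\<bar> > cmod (of_real (1 - r / 2) + \<i> * of_real \<omega>)) \<and>
      (3 * r + S = 0 \<longleftrightarrow> \<bar>1 + r\<bar> = cmod (of_real (1 - r / 2) + \<i> * of_real \<omega>)) \<and>
      (3 * r + S < 0 \<longleftrightarrow> \<bar>1 + r\<bar> < cmod (of_real (1 - r / 2) + \<i> * of_real \<omega>))"
    (is "?Q r \<omega>")
    if "Delta P < 0" and r: "r ^ 3 - S * r - R = 0" and w: "\<omega> = sqrt (3 * r\<^sup>2 / 4 - S)" for r \<omega> :: real
  proof -
    note root = disc_neg_root[OF that(1)[unfolded Delta] r, folded w]
    define m where "m = cmod (of_real (1 - r / 2) + \<i> * of_real \<omega>)"
    have "m\<^sup>2 = (1 - r / 2)\<^sup>2 + \<omega>\<^sup>2" by (simp add: m_def cmod_power2)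
    then have eq: "\<bar>1 + r\<bar>\<^sup>2 - m\<^sup>2 = 3 * r + S"
      unfolding power2_abs root(2) by (simp add: power2_eq_square field_simps)
    \<comment> \<open>Both moduli are nonnegative, so the sign of the difference of their squares
      decides their order.\<close>
    have "m\<^sup>2 \<le> \<bar>1 + r\<bar>\<^sup>2 \<longleftrightarrow> m \<le> \<bar>1 + r\<bar>" "\<bar>1 + r\<bar>\<^sup>2 \<le> m\<^sup>2 \<longleftrightarrow> \<bar>1 + r\<bar> \<le> m"
      by (intro power_mono_iff; simp add: m_def)+
    then have "3 * r + S > 0 \<longleftrightarrow> \<bar>1 + r\<bar> > m" "3 * r + S = 0 \<longleftrightarrow> \<bar>1 + r\<bar> = m"
      "3 * r + S < 0 \<longleftrightarrow> \<bar>1 + r\<bar> < m"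
      unfolding eq[symmetric] by linarith+
    then show ?thesis using root(1,3) eq unfolding m_def by blast
  qed
  have iii'': "(\<exists>!r::real. r ^ 3 - S * r - R = 0) \<and>
      (\<forall>r \<omega> :: real. r ^ 3 - S * r - R = 0 \<longrightarrow> \<omega> = sqrt (3 * r\<^sup>2 / 4 - S) \<longrightarrow> ?Q r \<omega>)"
    if "Delta P < 0"
    by (intro conjI[OF disc_neg_root_unique[OF that[unfolded Delta]]] allI impI iii'[OF that])
  have dominant: "(S < 12 \<longrightarrow> dominant_eigenvalues G = {3}) \<and>
      (S > 12 \<longrightarrow> dominant_eigenvalues G = {of_real (sqrt (S - 3)), - of_real (sqrt (S - 3))})"
    if "R = 8 - 2 * S" "S > 3"
  proof -
    define w where "w = sqrt (S - 3)"
    have "w \<ge> 0" using that by (simp add: w_def)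
    \<comment> \<open>The threshold 12 is where sqrt (S - 3) reaches 3 = sqrt 9.\<close>
    have lt: "w < 3 \<longleftrightarrow> S < 12" "w > 3 \<longleftrightarrow> S > 12"
      using real_sqrt_less_iff[of "S - 3" 9] real_sqrt_less_iff[of 9 "S - 3"]
      by (auto simp: w_def)
    define Q where "Q = (\<lambda>z. 3 \<le> cmod z \<and> w \<le> cmod z)"
    have "dominant_eigenvalues G = {z \<in> {3, of_real w, - of_real w}. Q z}"
      unfolding dominant_eigenvalues_def cmod_eq_locus[OF that] w_def[symmetric] Q_def
      using \<open>w \<ge> 0\<close> by auto
    \<comment> \<open>Splitting into conditional singletons reduces the dominant set to evaluating
      \<open>Q\<close> at the three candidates.\<close>
    then have dom: "dominant_eigenvalues G = (if Q 3 then {3} else {}) \<union>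
        (if Q (of_real w) then {of_real w} else {}) \<union> (if Q (- of_real w) then {- of_real w} else {})"
      by (simp only:) (simp split: if_split, blast)
    have "Q 3 \<longleftrightarrow> w \<le> 3" "Q (of_real w) \<longleftrightarrow> 3 \<le> w" "Q (- of_real w) \<longleftrightarrow> 3 \<le> w"
      using \<open>w \<ge> 0\<close> by (simp_all add: Q_def)
    then show ?thesis
      unfolding lt[symmetric] w_def[symmetric] dom by (simp add: insert_commute)
  qed
  show ?thesis
    unfolding G_def[symmetric] S_def[symmetric] R_def[symmetric]
  proof (intro conjI)
    show "\<forall>\<psi>. projective_transformation \<psi> \<longrightarrow>
        S_inv (\<lambda>i. \<psi> (P i)) = S \<and> R_inv (\<lambda>i. \<psi> (P i)) = R"
      using S_R_inv_projective[OF assms] by (simp add: S_def R_def)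
    show "\<forall>q. is_lift 6 P q \<longrightarrow>
        S = (\<Sum>i = 1..6. \<Sum>j = i+1..6. m_coeff q i j) - 3 \<and>
        R = 2 * S -
          (\<Sum>i = 1..6. \<Sum>j = i+1..6. \<Sum>k = j+1..6. Gamma_coeff q i j k + Gamma_coeff q i k j)"
      using S_inv_eq[OF poly] R_inv_eq[OF poly] bracket_lift_nonzero[OF assms]
      unfolding S_def R_def by blast
    show "three_distinct_real_eigenvalues G \<longrightarrow>
        ((\<exists>z w. z \<in># spectrum G \<and> w \<in># spectrum G \<and> z \<noteq> w \<and> cmod z = cmod w) \<longleftrightarrow>
         R = 8 - 2 * S \<and> S > 3 \<and> S \<noteq> 12) \<and>
        (R = 8 - 2 * S \<and> S > 3 \<and> S \<noteq> 12 \<longrightarrow>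
           spectrum G = {#3, of_real (sqrt (S - 3)), - of_real (sqrt (S - 3))#} \<and>
           (S < 12 \<longrightarrow> dominant_eigenvalues G = {3}) \<and>
           (S > 12 \<longrightarrow> dominant_eigenvalues G =
              {of_real (sqrt (S - 3)), - of_real (sqrt (S - 3))}))"
      unfolding three_distinct_real_eigenvalues_def
      by (intro impI conjI) (erule cmod_eq_iff, simp_all add: cmod_eq_locus dominant)
    show "\<forall>t. poly (charpoly G) t = (t - 1) ^ 3 - S * (t - 1) - R"
      using charpoly ..
    show "Delta P > 0 \<longleftrightarrow> three_distinct_real_eigenvalues G"
      "Delta P = 0 \<longleftrightarrow> has_repeated_real_eigenvalue G"
      "Delta P < 0 \<longleftrightarrow> has_nonreal_conjugate_pair G"
      by (fact i ii iii)+
  qed (rule impI, erule ii', rule impI, erule iii'')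
qed

end
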